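(* Let $G=(V,E)$ be a finite graph. (1) Let $q\ge 1$ be real and let $p,\tilde p\in[0,1]^E$ satisfy $p_e\le\tilde p_e$ for every $e\in E$. Then $$\mathrm{FK}_{p,q}\preccurlyeq \mathrm{FK}_{\tilde p,q}\cap \mathrm{Ber}_{p/\tilde p},$$ where $p/\tilde p$ is understood edgewise. (2) More generally, for all real numbers $q,\tilde q\ge 1$ and all $p,\tilde p\in[0,1]^E$ (with no order relation assumed between $p$ and $\tilde p$), $$\mathrm{FK}_{p\tilde p,\,q\tilde q}\preccurlyeq \mathrm{FK}_{p,q}\cap\mathrm{FK}_{\tilde p,\tilde q}$$ and $$\mathrm{FK}_{p,q}\cup\mathrm{FK}_{\tilde p,\tilde q}\preccurlyeq \mathrm{FK}_{\widehat p,\,q\tilde q},$$ where $p\tilde p$ is the edgewise product and, edgewise, $$\widehat p=\frac{p\tilde p+p\tilde q(1-\tilde p)+\tilde p q(1-p)}{(1-p)(1-\tilde p)+p\tilde p+p\tilde q(1-\tilde p)+\tilde p q(1-p)}.$$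
   Context: Percolation configurations $\omega\in\{0,1\}^E$ are identified with subsets of $E$ (the set of open edges). For $p\in[0,1]^E$ and $q>0$, the FK percolation (random-cluster) measure with free boundary conditions is the probability measure on $\{0,1\}^E$ $$\mathrm{FK}_{p,q}(\omega)\propto q^{k(\omega)}\prod_{e\in E}p_e^{\omega_e}(1-p_e)^{1-\omega_e},$$ where $k(\omega)$ is the number of connected components of the graph $(V,\omega)$. $\mathrm{Ber}_p=\mathrm{FK}_{p,1}$ is the product Bernoulli measure. For probability measures $\mu,\nu$ on $\{0,1\}^E$, $\mu\cap\nu$ (resp. $\mu\cup\nu$) is the law of $\omega\cap\omega'$ (resp. $\omega\cup\omega'$) for independent $\omega\sim\mu$, $\omega'\sim\nu$. $\mu\preccurlyeq\nu$ denotes stochastic domination: $\mu(A)\le\nu(A)$ for every increasing event $A\subseteq\{0,1\}^E$. In the ratio $p/\tilde p$, at an edge with $\tilde p_e=0$ (hence $p_e=0$) the ratio may be given any value in $[0,1]$. *)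

theory Defs
  imports "HOL-Probability.Probability"
begin

text \<open>
  Finite undirected graphs. Edges are abstract labels with an endpoint map, so parallel edges
  and loops are permitted; a simple graph is the case where \<open>ends G\<close> is injective
  on \<open>edges G\<close> and takes only two-element values there.
\<close>

record ('v, 'e) graph =
  verts :: "'v set"
  edges :: "'e set"
  ends :: "'e \<Rightarrow> 'v set"

definition finite_graph :: "('v, 'e) graph \<Rightarrow> bool" where
  "finite_graph G \<longleftrightarrow> finite (verts G) \<and> finite (edges G) \<and>
     (\<forall>e\<in>edges G. ends G e \<subseteq> verts G \<and> card (ends G e) \<in> {1, 2})"

definition connected_rel :: "('v, 'e) graph \<Rightarrow> 'e set \<Rightarrow> ('v \<times> 'v) set" where
  "connected_rel G \<omega> = {(u, v). \<exists>e\<in>\<omega>. ends G e = {u, v}}\<^sup>* \<inter> verts G \<times> verts G"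

definition num_components :: "('v, 'e) graph \<Rightarrow> 'e set \<Rightarrow> nat" where
  "num_components G \<omega> = card (verts G // connected_rel G \<omega>)"

definition FK_weight :: "('v, 'e) graph \<Rightarrow> ('e \<Rightarrow> real) \<Rightarrow> real \<Rightarrow> 'e set \<Rightarrow> real" where
  "FK_weight G p q \<omega> =
     q ^ num_components G \<omega> * (\<Prod>e\<in>edges G. if e \<in> \<omega> then p e else 1 - p e)"

definition FK_partition :: "('v, 'e) graph \<Rightarrow> ('e \<Rightarrow> real) \<Rightarrow> real \<Rightarrow> real" where
  "FK_partition G p q = (\<Sum>\<omega>\<in>Pow (edges G). FK_weight G p q \<omega>)"

text \<open>
  Configurations are sets of open edges, so the measures live on the type \<open>'e set\<close> and are
  supported on \<open>Pow (edges G)\<close>. The lemma \<open>pmf_FK\<close> below shows that the argument of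
  \<open>embed_pmf\<close> is a probability mass function for all admissible parameters.
\<close>

definition FK :: "('v, 'e) graph \<Rightarrow> ('e \<Rightarrow> real) \<Rightarrow> real \<Rightarrow> 'e set pmf" where
  "FK G p q = embed_pmf (\<lambda>\<omega>. if \<omega> \<subseteq> edges G then FK_weight G p q \<omega> / FK_partition G p q else 0)"

definition Ber :: "('v, 'e) graph \<Rightarrow> ('e \<Rightarrow> real) \<Rightarrow> 'e set pmf" where
  "Ber G p = FK G p 1"

definition inter_law :: "'e set pmf \<Rightarrow> 'e set pmf \<Rightarrow> 'e set pmf" where
  "inter_law \<mu> \<nu> = map_pmf (\<lambda>(\<omega>, \<omega>'). \<omega> \<inter> \<omega>') (pair_pmf \<mu> \<nu>)"

definition union_law :: "'e set pmf \<Rightarrow> 'e set pmf \<Rightarrow> 'e set pmf" where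
  "union_law \<mu> \<nu> = map_pmf (\<lambda>(\<omega>, \<omega>'). \<omega> \<union> \<omega>') (pair_pmf \<mu> \<nu>)"

definition increasing_event :: "'e set \<Rightarrow> 'e set set \<Rightarrow> bool" where
  "increasing_event E A \<longleftrightarrow> A \<subseteq> Pow E \<and> (\<forall>\<omega>\<in>A. \<forall>\<omega>'. \<omega> \<subseteq> \<omega>' \<and> \<omega>' \<subseteq> E \<longrightarrow> \<omega>' \<in> A)"

definition stoch_dominated :: "'e set \<Rightarrow> 'e set pmf \<Rightarrow> 'e set pmf \<Rightarrow> bool" where
  "stoch_dominated E \<mu> \<nu> \<longleftrightarrow>
     (\<forall>A. increasing_event E A \<longrightarrow> measure_pmf.prob \<mu> A \<le> measure_pmf.prob \<nu> A)"

definition edge_params :: "('v, 'e) graph \<Rightarrow> ('e \<Rightarrow> real) \<Rightarrow> bool" where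
  "edge_params G p \<longleftrightarrow> (\<forall>e\<in>edges G. 0 \<le> p e \<and> p e \<le> 1)"

definition p_hat :: "real \<Rightarrow> real \<Rightarrow> real \<Rightarrow> real \<Rightarrow> real" where
  "p_hat q q' x x' =
     (x * x' + x * q' * (1 - x') + x' * q * (1 - x)) /
     ((1 - x) * (1 - x') + x * x' + x * q' * (1 - x') + x' * q * (1 - x))"

lemma FK_weight_nonneg:
  assumes "edge_params G p" "q > 0"
  shows "FK_weight G p q \<omega> \<ge> 0"
  using assms by (auto simp: FK_weight_def edge_params_def intro!: mult_nonneg_nonneg prod_nonneg)

lemma FK_partition_pos:
  assumes "finite_graph G" "edge_params G p" "q > 0"
  shows "FK_partition G p q > 0"
proof -
  let ?\<omega> = "{e\<in>edges G. p e > 0}"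
  have fin: "finite (edges G)"
    using assms(1) by (simp add: finite_graph_def)
  have "(\<Prod>e\<in>edges G. if e \<in> ?\<omega> then p e else 1 - p e) > 0"
    using assms(2) by (intro prod_pos) (auto simp: edge_params_def)
  hence "FK_weight G p q ?\<omega> > 0"
    using assms(3) by (simp add: FK_weight_def)
  moreover have "FK_weight G p q ?\<omega> \<le> FK_partition G p q"
    unfolding FK_partition_def
    by (rule member_le_sum) (use fin FK_weight_nonneg[OF assms(2,3)] in auto)
  ultimately show ?thesis by linarith
qed

lemma pmf_FK:
  assumes "finite_graph G" "edge_params G p" "q > 0"
  shows "pmf (FK G p q) \<omega> =
    (if \<omega> \<subseteq> edges G then FK_weight G p q \<omega> / FK_partition G p q else 0)"
proof -
  let ?f = "\<lambda>\<omega>. if \<omega> \<subseteq> edges G then FK_weight G p q \<omega> / FK_partition G p q else 0"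
  have fin: "finite (Pow (edges G))"
    using assms(1) by (simp add: finite_graph_def)
  have Z: "FK_partition G p q > 0"
    using assms by (rule FK_partition_pos)
  have nonneg: "?f \<omega> \<ge> 0" for \<omega>
    using Z FK_weight_nonneg[OF assms(2,3)] by auto
  have "(\<integral>\<^sup>+\<omega>. ennreal (?f \<omega>) \<partial>count_space UNIV) = (\<Sum>\<omega>\<in>Pow (edges G). ennreal (?f \<omega>))"
    by (rule nn_integral_count_space'[OF fin]) auto
  also have "\<dots> = ennreal (\<Sum>\<omega>\<in>Pow (edges G). ?f \<omega>)"
    using nonneg by (intro sum_ennreal)
  also have "(\<Sum>\<omega>\<in>Pow (edges G). ?f \<omega>) =
      (\<Sum>\<omega>\<in>Pow (edges G). FK_weight G p q \<omega>) / FK_partition G p q"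
    unfolding sum_divide_distrib by (intro sum.cong) auto
  also have "\<dots> = 1"
    using Z by (simp add: FK_partition_def)
  finally show ?thesis
    unfolding FK_def using nonneg by (subst pmf_embed_pmf) auto
qed

end

(* By monotonicity of FK measures with q \<ge> 1, comparisons can be checked edge by edge: it suffices
   that, conditionally on the configuration outside any edge e, the odds of e being open compare.
   Given two independent FK configurations outside e, the state of e in each is an independent
   Bernoulli variable of parameter p if the endpoints are already connected and p / (p + q (1 - p))
   otherwise. Since the intersection is contained in both configurations (and the union contains
   them), connectivity of the endpoints in one implies it in the other, and the comparison of the
   odds is an elementary inequality. Edge-by-edge comparison gives Holley's lattice condition, and
   the four functions theorem turns this into stochastic domination. The first part is the second
   one with one cluster weight equal to 1. *)

theory Submission
  imports Defs
begin

section \<open>Holley's criterion\<close>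

lemma sum_Pow_insert:
  fixes f :: "'a set \<Rightarrow> 'b::comm_monoid_add"
  assumes "finite F" "e \<notin> F"
  shows "(\<Sum>a\<in>Pow (insert e F). f a) = (\<Sum>a\<in>Pow F. f a + f (insert e a))"
proof -
  have "inj_on (insert e) (Pow F)"
    using assms(2) by (intro inj_onI) (metis PowD insert_ident subsetD)
  moreover have "Pow F \<inter> insert e ` Pow F = {}"
    using assms(2) by auto
  ultimately show ?thesis
    using assms(1) by (simp add: Pow_insert sum.union_disjoint sum.reindex sum.distrib)
qed

text \<open>This is the one-element case of the four functions theorem. The diagonal products are
  bounded directly. For the cross terms put u = \<open>a0 * b1\<close>, v = \<open>a1 * b0\<close>,
  w = \<open>c1 * d0\<close>: then u and v are at most w and u v is at most w times
  \<open>c0 * d1\<close>, so expanding (w - u)(w - v) \<ge> 0 and cancelling w gives the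
  bound.\<close>

lemma four_functions_two_point:
  fixes a0 a1 b0 b1 c0 c1 d0 d1 :: real
  assumes nonneg: "a0 \<ge> 0" "a1 \<ge> 0" "b0 \<ge> 0" "b1 \<ge> 0" "c0 \<ge> 0" "c1 \<ge> 0" "d0 \<ge> 0" "d1 \<ge> 0"
    and le: "a0 * b0 \<le> c0 * d0" "a0 * b1 \<le> c1 * d0" "a1 * b0 \<le> c1 * d0" "a1 * b1 \<le> c1 * d1"
  shows "(a0 + a1) * (b0 + b1) \<le> (c0 + c1) * (d0 + d1)"
proof -
  have cross: "a0 * b1 + a1 * b0 \<le> c1 * d0 + c0 * d1"
  proof (cases "c1 * d0 = 0")
    case True
    then have "a0 * b1 + a1 * b0 \<le> 0" using le(2,3) by linarith
    moreover have "0 \<le> c1 * d0 + c0 * d1" using nonneg by simp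
    ultimately show ?thesis by linarith
  next
    case False
    hence pos: "c1 * d0 > 0" using nonneg by (simp add: less_le)
    have "(a0 * b0) * (a1 * b1) \<le> (c0 * d0) * (c1 * d1)"
      using mult_mono[OF le(1,4)] nonneg by simp
    moreover have "0 \<le> (c1 * d0 - a0 * b1) * (c1 * d0 - a1 * b0)"
      using le by simp
    ultimately have "(c1 * d0) * (a0 * b1 + a1 * b0) \<le> (c1 * d0) * (c1 * d0 + c0 * d1)"
      by (simp add: algebra_simps)
    then show ?thesis using pos by (simp only: mult_le_cancel_left_pos)
  qed
  show ?thesis
    using cross le(1,4) by (simp add: algebra_simps)
qed

text \<open>The Ahlswede-Daykin inequality, by induction on the ground set: summing out one element
  from all four functions preserves the hypothesis, by the two-point case.\<close>

lemma four_functions: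
  fixes \<alpha> \<beta> \<gamma> \<delta> :: "'a set \<Rightarrow> real"
  assumes "finite E"
    and "\<And>a. a \<subseteq> E \<Longrightarrow> \<alpha> a \<ge> 0 \<and> \<beta> a \<ge> 0 \<and> \<gamma> a \<ge> 0 \<and> \<delta> a \<ge> 0"
    and "\<And>a b. a \<subseteq> E \<Longrightarrow> b \<subseteq> E \<Longrightarrow> \<alpha> a * \<beta> b \<le> \<gamma> (a \<union> b) * \<delta> (a \<inter> b)"
  shows "(\<Sum>a\<in>Pow E. \<alpha> a) * (\<Sum>a\<in>Pow E. \<beta> a) \<le> (\<Sum>a\<in>Pow E. \<gamma> a) * (\<Sum>a\<in>Pow E. \<delta> a)"
  using assms
proof (induction E arbitrary: \<alpha> \<beta> \<gamma> \<delta> rule: finite_induct)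
  case empty
  then show ?case by force
next
  case (insert e F)
  let ?s = "\<lambda>f a. f a + f (insert e a)"
  have nonneg: "\<alpha> a \<ge> 0" "\<beta> a \<ge> 0" "\<gamma> a \<ge> 0" "\<delta> a \<ge> 0"
      "\<alpha> (insert e a) \<ge> 0" "\<beta> (insert e a) \<ge> 0" "\<gamma> (insert e a) \<ge> 0" "\<delta> (insert e a) \<ge> 0"
    if "a \<subseteq> F" for a
    using insert.prems(1)[of a] insert.prems(1)[of "insert e a"] that by auto
  \<comment> \<open>The index 0 or 1 in the two-point lemma records whether \<open>e\<close> is
    present; its four hypotheses are the four ways of adding \<open>e\<close> to \<open>a\<close>
    and \<open>b\<close>.\<close>
  have "?s \<alpha> a * ?s \<beta> b \<le> ?s \<gamma> (a \<union> b) * ?s \<delta> (a \<inter> b)" if ab: "a \<subseteq> F" "b \<subseteq> F" for a b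
  proof (rule four_functions_two_point)
    have e: "e \<notin> a" "e \<notin> b" using ab insert.hyps by auto
    have sub: "a \<subseteq> insert e F" "b \<subseteq> insert e F"
      "insert e a \<subseteq> insert e F" "insert e b \<subseteq> insert e F" using ab by auto
    show "\<alpha> a * \<beta> b \<le> \<gamma> (a \<union> b) * \<delta> (a \<inter> b)"
      using insert.prems(2)[OF sub(1,2)] .
    show "\<alpha> a * \<beta> (insert e b) \<le> \<gamma> (insert e (a \<union> b)) * \<delta> (a \<inter> b)"
      using insert.prems(2)[OF sub(1,4)] e by simp
    show "\<alpha> (insert e a) * \<beta> b \<le> \<gamma> (insert e (a \<union> b)) * \<delta> (a \<inter> b)"
      using insert.prems(2)[OF sub(3,2)] e by simp
    show "\<alpha> (insert e a) * \<beta> (insert e b) \<le> \<gamma> (insert e (a \<union> b)) * \<delta> (insert e (a \<inter> b))"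
      using insert.prems(2)[OF sub(3,4)] e by (simp add: Int_insert_left Int_insert_right)
  qed (use nonneg[of a] nonneg[of b] nonneg[of "a \<union> b"] nonneg[of "a \<inter> b"] ab in auto)
  then have "(\<Sum>a\<in>Pow F. ?s \<alpha> a) * (\<Sum>a\<in>Pow F. ?s \<beta> a) \<le>
      (\<Sum>a\<in>Pow F. ?s \<gamma> a) * (\<Sum>a\<in>Pow F. ?s \<delta> a)"
    using nonneg by (intro insert.IH) (auto intro!: add_nonneg_nonneg)
  then show ?case
    unfolding sum_Pow_insert[OF insert.hyps(1,2)] .
qed

lemma prob_eq_sum_Pow:
  assumes "finite E" "set_pmf \<mu> \<subseteq> Pow E"
  shows "measure_pmf.prob \<mu> A = (\<Sum>a\<in>Pow E. if a \<in> A then pmf \<mu> a else 0)"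
proof -
  have "measure_pmf.prob \<mu> A = measure_pmf.prob \<mu> (A \<inter> set_pmf \<mu>)"
    by (simp add: measure_Int_set_pmf)
  also have "\<dots> = measure_pmf.prob \<mu> (Pow E \<inter> A)"
    using assms(2) by (intro measure_prob_cong_0) (auto simp: set_pmf_iff)
  also have "\<dots> = (\<Sum>a\<in>Pow E \<inter> A. pmf \<mu> a)"
    using assms(1) by (intro measure_measure_pmf_finite) auto
  finally show ?thesis
    using assms(1) by (simp add: sum.inter_restrict)
qed

text \<open>The four functions theorem applies with the indicator of the event attached to
  \<open>\<mu>\<close> on the left and to \<open>\<nu>\<close> on the right, because an increasing
  event containing \<open>a\<close> contains \<open>a \<union> b\<close>. The two remaining sums are
  total masses, equal to 1.\<close>

lemma Holley_lattice:
  assumes fin: "finite E" and supp: "set_pmf \<mu> \<subseteq> Pow E" "set_pmf \<nu> \<subseteq> Pow E"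
    and lattice: "\<And>a b. a \<subseteq> E \<Longrightarrow> b \<subseteq> E \<Longrightarrow>
      pmf \<mu> a * pmf \<nu> b \<le> pmf \<mu> (a \<inter> b) * pmf \<nu> (a \<union> b)"
  shows "stoch_dominated E \<mu> \<nu>"
  unfolding stoch_dominated_def
proof (intro allI impI)
  fix A assume A: "increasing_event E A"
  have total: "(\<Sum>a\<in>Pow E. pmf \<rho> a) = 1" if "set_pmf \<rho> \<subseteq> Pow E" for \<rho>
    using fin that by (intro sum_pmf_eq_1) auto
  have "(\<Sum>a\<in>Pow E. if a \<in> A then pmf \<mu> a else 0) * (\<Sum>a\<in>Pow E. pmf \<nu> a) \<le>
      (\<Sum>a\<in>Pow E. if a \<in> A then pmf \<nu> a else 0) * (\<Sum>a\<in>Pow E. pmf \<mu> a)"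
  proof (rule four_functions[OF fin])
    fix a b assume ab: "a \<subseteq> E" "b \<subseteq> E"
    have "a \<union> b \<in> A" if "a \<in> A"
    proof -
      have "a \<subseteq> a \<union> b" "a \<union> b \<subseteq> E" using ab by auto
      then show ?thesis using A that unfolding increasing_event_def by blast
    qed
    then show "(if a \<in> A then pmf \<mu> a else 0) * pmf \<nu> b \<le>
        (if a \<union> b \<in> A then pmf \<nu> (a \<union> b) else 0) * pmf \<mu> (a \<inter> b)"
      using lattice[OF ab] by (auto simp: mult.commute)
  qed auto
  then show "measure_pmf.prob \<mu> A \<le> measure_pmf.prob \<nu> A"
    by (simp add: total supp prob_eq_sum_Pow[OF fin])
qed

text \<open>The assumption \<open>degenerate\<close> covers edges that are almost surely open under \<open>\<mu>\<close>, where the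
  odds in \<open>edge\<close> carry no information.\<close>

lemma Holley_single_edge:
  assumes fin: "finite E" and supp: "set_pmf \<mu> \<subseteq> Pow E" "set_pmf \<nu> \<subseteq> Pow E"
    and edge: "\<And>x y e. x \<subseteq> y \<Longrightarrow> y \<subseteq> E \<Longrightarrow> e \<in> E \<Longrightarrow> e \<notin> y \<Longrightarrow>
      pmf \<mu> (insert e x) * pmf \<nu> y \<le> pmf \<mu> x * pmf \<nu> (insert e y)"
    and degenerate: "\<And>x y e. x \<subseteq> E \<Longrightarrow> y \<subseteq> E \<Longrightarrow> e \<in> E \<Longrightarrow> e \<notin> x \<Longrightarrow> e \<notin> y \<Longrightarrow>
      pmf \<mu> x = 0 \<Longrightarrow> pmf \<mu> (insert e x) \<noteq> 0 \<Longrightarrow> pmf \<nu> y = 0"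
  shows "stoch_dominated E \<mu> \<nu>"
proof (rule Holley_lattice[OF fin supp])
  fix a b assume ab: "a \<subseteq> E" "b \<subseteq> E"
  \<comment> \<open>The lattice condition is reached by opening the edges of \<open>D\<close> one at
    a time and telescoping the single-edge inequalities. It is the case where \<open>z\<close> is
    \<open>a \<inter> b\<close> and \<open>D\<close> is \<open>a - b\<close>.\<close>
  have "pmf \<mu> (z \<union> D) * pmf \<nu> b \<le> pmf \<mu> z * pmf \<nu> (b \<union> D)"
    if "finite D" "D \<subseteq> E" "D \<inter> b = {}" "z \<subseteq> b" for z D
    using that
  proof (induction D rule: finite_induct)
    case empty
    then show ?case by simp
  next
    case (insert e D)
    let ?x = "z \<union> D" and ?y = "b \<union> D"
    have e: "e \<notin> ?x" "e \<notin> ?y" using insert by auto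
    have xy: "?x \<subseteq> ?y" "?x \<subseteq> E" "?y \<subseteq> E" "e \<in> E" using insert ab by auto
    have IH: "pmf \<mu> ?x * pmf \<nu> b \<le> pmf \<mu> z * pmf \<nu> ?y"
      using insert by auto
    have step: "pmf \<mu> (insert e ?x) * pmf \<nu> ?y \<le> pmf \<mu> ?x * pmf \<nu> (insert e ?y)"
      using edge[OF xy(1,3,4) e(2)] .
    have "pmf \<mu> (insert e ?x) * pmf \<nu> b \<le> pmf \<mu> z * pmf \<nu> (insert e ?y)"
    proof (cases "pmf \<mu> (insert e ?x) = 0 \<or> pmf \<nu> b = 0")
      case True
      then show ?thesis by auto
    next
      case False
      \<comment> \<open>Chaining \<open>IH\<close> with \<open>step\<close> leaves a factor
        \<open>pmf \<mu> ?x\<close> on both sides; \<open>degenerate\<close>, taken at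
        \<open>b\<close>, allows it to be cancelled.\<close>
      hence "pmf \<mu> ?x \<noteq> 0"
        using degenerate[OF xy(2) ab(2) xy(4) e(1)] e by auto
      hence x_pos: "pmf \<mu> ?x > 0" by (simp add: less_le)
      have "pmf \<mu> ?x * (pmf \<mu> (insert e ?x) * pmf \<nu> b) =
          pmf \<mu> (insert e ?x) * (pmf \<mu> ?x * pmf \<nu> b)" by (simp add: ac_simps)
      also have "\<dots> \<le> pmf \<mu> (insert e ?x) * (pmf \<mu> z * pmf \<nu> ?y)"
        using IH by (intro mult_left_mono) auto
      also have "\<dots> = pmf \<mu> z * (pmf \<mu> (insert e ?x) * pmf \<nu> ?y)" by (simp add: ac_simps)
      also have "\<dots> \<le> pmf \<mu> z * (pmf \<mu> ?x * pmf \<nu> (insert e ?y))"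
        using step by (intro mult_left_mono) auto
      also have "\<dots> = pmf \<mu> ?x * (pmf \<mu> z * pmf \<nu> (insert e ?y))" by (simp add: ac_simps)
      finally show ?thesis using x_pos by (simp only: mult_le_cancel_left_pos)
    qed
    then show ?case by simp
  qed
  from this[of "a - b" "a \<inter> b"]
  have "pmf \<mu> ((a \<inter> b) \<union> (a - b)) * pmf \<nu> b \<le> pmf \<mu> (a \<inter> b) * pmf \<nu> (b \<union> (a - b))"
    using ab fin by (auto intro: finite_subset)
  moreover have "(a \<inter> b) \<union> (a - b) = a" "b \<union> (a - b) = a \<union> b" by auto
  ultimately show "pmf \<mu> a * pmf \<nu> b \<le> pmf \<mu> (a \<inter> b) * pmf \<nu> (a \<union> b)"
    by simp
qed

section \<open>Opening one edge\<close>

text \<open>Using the whole endpoint set avoids choosing an order of the endpoints and makes a loop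
  of the graph count as joined.\<close>

definition joined :: "('v, 'e) graph \<Rightarrow> 'e \<Rightarrow> 'e set \<Rightarrow> bool" where
  "joined G e \<omega> \<longleftrightarrow> ends G e \<times> ends G e \<subseteq> connected_rel G \<omega>"

text \<open>The number of clusters lost when \<open>e\<close> is opened, hence the exponent of the
  cluster weight in the odds of \<open>e\<close>.\<close>

abbreviation cut_index :: "('v, 'e) graph \<Rightarrow> 'e \<Rightarrow> 'e set \<Rightarrow> nat" where
  "cut_index G e \<omega> \<equiv> (if joined G e \<omega> then 0 else 1)"

lemma connected_rel_mono: "\<omega> \<subseteq> \<omega>' \<Longrightarrow> connected_rel G \<omega> \<subseteq> connected_rel G \<omega>'"
  unfolding connected_rel_def by (intro Int_mono rtrancl_mono) auto

lemma cut_index_antimono: "\<omega> \<subseteq> \<omega>' \<Longrightarrow> cut_index G e \<omega>' \<le> cut_index G e \<omega>"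
  using connected_rel_mono[of \<omega> \<omega>' G] by (auto simp: joined_def)

lemma equiv_connected_rel: "equiv (verts G) (connected_rel G \<omega>)"
proof (rule equivI)
  have "sym ({(u, v). \<exists>e\<in>\<omega>. ends G e = {u, v}}\<^sup>*)"
    by (intro sym_rtrancl) (auto simp: sym_def insert_commute)
  then show "sym (connected_rel G \<omega>)"
    unfolding connected_rel_def by (auto simp: sym_def)
  show "trans (connected_rel G \<omega>)"
    unfolding connected_rel_def by (auto simp: trans_def)
qed (auto simp: connected_rel_def refl_on_def)

text \<open>Only the classes of the two endpoints can merge: a path using the new edge may be
  shortened until it crosses that edge at most once.\<close>

lemma connected_rel_insert:
  assumes G: "finite_graph G" and \<omega>: "\<omega> \<subseteq> edges G" and e: "e \<in> edges G" "ends G e = {u, v}"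
  shows "connected_rel G (insert e \<omega>) = connected_rel G \<omega>
    \<union> connected_rel G \<omega> `` {u} \<times> connected_rel G \<omega> `` {v}
    \<union> connected_rel G \<omega> `` {v} \<times> connected_rel G \<omega> `` {u}"
  (is "_ = ?R \<union> ?R``{u} \<times> ?R``{v} \<union> ?R``{v} \<times> ?R``{u}")
proof -
  let ?r = "{(u, v). \<exists>e\<in>\<omega>. ends G e = {u, v}}"
  let ?r' = "{(u, v). \<exists>e\<in>insert e \<omega>. ends G e = {u, v}}"
  let ?T = "?R \<union> ?R``{u} \<times> ?R``{v} \<union> ?R``{v} \<times> ?R``{u}"
  have eq: "equiv (verts G) ?R" by (rule equiv_connected_rel)
  have sy: "(b, a) \<in> ?R" if "(a, b) \<in> ?R" for a b using eq that by (meson equivE symE)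
  have tr: "(a, c) \<in> ?R" if "(a, b) \<in> ?R" "(b, c) \<in> ?R" for a b c
    using eq that by (meson equivE transE)
  have uv: "u \<in> verts G" "v \<in> verts G" using G e unfolding finite_graph_def by auto
  have re: "(a, a) \<in> ?R" if "a \<in> verts G" for a using that by (auto simp: connected_rel_def)
  have "?T \<subseteq> connected_rel G (insert e \<omega>)"
  proof -
    have mono: "?R \<subseteq> connected_rel G (insert e \<omega>)" by (rule connected_rel_mono) auto
    have eq': "equiv (verts G) (connected_rel G (insert e \<omega>))" by (rule equiv_connected_rel)
    have uv': "(u, v) \<in> connected_rel G (insert e \<omega>)"
      using uv e by (auto simp: connected_rel_def)
    have "(a, b) \<in> connected_rel G (insert e \<omega>)" if "(u, a) \<in> ?R" "(v, b) \<in> ?R" for a b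
      using that uv' mono eq' by (meson equivE subsetD symE transE)
    moreover have "(a, b) \<in> connected_rel G (insert e \<omega>)" if "(v, a) \<in> ?R" "(u, b) \<in> ?R" for a b
      using that uv' mono eq' by (meson equivE subsetD symE transE)
    ultimately show ?thesis using mono by auto
  qed
  moreover have "(x, y) \<in> ?T" if xy: "(x, y) \<in> ?r'\<^sup>*" and x: "x \<in> verts G" for x y
    using xy
  proof (induction rule: rtrancl_induct)
    case base
    then show ?case using re[OF x] by simp
  next
    case (step y z)
    then obtain f where f: "f \<in> insert e \<omega>" "ends G f = {y, z}" by auto
    hence yz: "y \<in> verts G" "z \<in> verts G" using G \<omega> e unfolding finite_graph_def by blast+
    \<comment> \<open>The last step of the path stays in an old class or crosses \<open>e\<close> in
      one of the two directions. Crossing back after an earlier crossing returns to the class of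
      \<open>x\<close>.\<close>
    consider "(y, z) \<in> ?R" | "y = u" "z = v" | "y = v" "z = u"
    proof (cases "f = e")
      case True
      then show thesis using that f e by (auto simp: doubleton_eq_iff)
    next
      case False
      then show thesis using that f yz by (auto simp: connected_rel_def)
    qed
    moreover have IH: "(x, y) \<in> ?R \<or> (u, x) \<in> ?R \<and> (v, y) \<in> ?R \<or> (v, x) \<in> ?R \<and> (u, y) \<in> ?R"
      using step.IH by auto
    ultimately show ?case
    proof cases
      case 1
      then show ?thesis using IH tr[OF _ 1] by auto
    next
      case 2
      then have "(u, x) \<in> ?R \<or> (x, v) \<in> ?R" using IH sy by blast
      then show ?thesis using 2 re[OF uv(2)] by auto
    next
      case 3
      then have "(v, x) \<in> ?R \<or> (x, u) \<in> ?R" using IH sy by blast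
      then show ?thesis using 3 re[OF uv(1)] by auto
    qed
  qed
  ultimately show ?thesis
    by (auto simp: connected_rel_def)
qed

text \<open>If the endpoints are already connected, the relation does not change; otherwise their
  two classes are replaced by the union. The additive form avoids subtraction on naturals.\<close>

lemma num_components_insert:
  assumes G: "finite_graph G" and \<omega>: "\<omega> \<subseteq> edges G" and e: "e \<in> edges G"
  shows "num_components G \<omega> = num_components G (insert e \<omega>) + cut_index G e \<omega>"
proof -
  let ?R = "connected_rel G \<omega>" and ?R' = "connected_rel G (insert e \<omega>)" and ?V = "verts G"
  have "card (ends G e) = 1 \<or> card (ends G e) = 2"
    using G e unfolding finite_graph_def by auto
  then obtain u v where uv: "ends G e = {u, v}"
    by (metis card_1_singletonE card_2_iff insert_absorb2)
  have V: "finite ?V" "u \<in> ?V" "v \<in> ?V" using G e uv unfolding finite_graph_def by auto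
  have eq: "equiv ?V ?R" by (rule equiv_connected_rel)
  have sy: "(b, a) \<in> ?R" if "(a, b) \<in> ?R" for a b using eq that by (meson equivE symE)
  have tr: "(a, c) \<in> ?R" if "(a, b) \<in> ?R" "(b, c) \<in> ?R" for a b c
    using eq that by (meson equivE transE)
  have re: "(a, a) \<in> ?R" if "a \<in> ?V" for a using that by (auto simp: connected_rel_def)
  have R': "?R' = ?R \<union> ?R``{u} \<times> ?R``{v} \<union> ?R``{v} \<times> ?R``{u}"
    by (rule connected_rel_insert[OF G \<omega> e uv])
  have joined_iff: "joined G e \<omega> \<longleftrightarrow> (u, v) \<in> ?R"
    using sy re V uv by (auto simp: joined_def)
  show ?thesis
  proof (cases "(u, v) \<in> ?R")
    case True
    hence "?R' = ?R" unfolding R' using sy tr by blast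
    then show ?thesis using True joined_iff by (simp add: num_components_def)
  next
    case False
    let ?U = "?R``{u}" and ?W = "?R``{v}"
    have in_quot: "?U \<in> ?V // ?R" "?W \<in> ?V // ?R" using V by (auto intro: quotientI)
    have ne: "?U \<noteq> ?W" using False re[OF V(3)] by auto
    have cls: "?R' `` {x} = (if x \<in> ?U \<union> ?W then ?U \<union> ?W else ?R `` {x})" for x
    proof -
      have "?R' `` {x} = ?U \<union> ?W" if "(u, x) \<in> ?R"
        unfolding R' using that sy tr by blast
      moreover have "?R' `` {x} = ?U \<union> ?W" if "(v, x) \<in> ?R"
        unfolding R' using that sy tr by blast
      moreover have "?R' `` {x} = ?R `` {x}" if "x \<notin> ?U \<union> ?W"
        unfolding R' using that by auto
      ultimately show ?thesis by auto
    qed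
    have old: "?R `` {x} = ?U \<or> ?R `` {x} = ?W" if "x \<in> ?U \<union> ?W" for x
      using that eq by (metis Image_singleton_iff UnE equiv_class_eq)
    have fresh: "?R `` {x} \<noteq> ?U" "?R `` {x} \<noteq> ?W" "?R `` {x} \<noteq> ?U \<union> ?W"
      if "x \<in> ?V" "x \<notin> ?U \<union> ?W" for x
      using re[OF that(1)] that(2) by blast+
    have quot: "?V // ?R' = insert (?U \<union> ?W) (?V // ?R - {?U, ?W})"
    proof (intro equalityI subsetI)
      fix C assume "C \<in> ?V // ?R'"
      then obtain x where "x \<in> ?V" "C = ?R' `` {x}" by (auto elim: quotientE)
      then show "C \<in> insert (?U \<union> ?W) (?V // ?R - {?U, ?W})"
        using fresh[of x] by (auto simp: cls intro: quotientI split: if_splits)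
    next
      fix C assume C: "C \<in> insert (?U \<union> ?W) (?V // ?R - {?U, ?W})"
      show "C \<in> ?V // ?R'"
      proof (cases "C = ?U \<union> ?W")
        case True
        hence "C = ?R' `` {u}" using re[OF V(2)] by (auto simp: cls)
        then show ?thesis using V by (auto intro: quotientI)
      next
        case False
        then have "C \<in> ?V // ?R" and ne': "C \<noteq> ?U" "C \<noteq> ?W" using C by blast+
        then obtain x where x: "x \<in> ?V" "C = ?R `` {x}" by (meson quotientE)
        hence "C = ?R' `` {x}" using old[of x] ne' by (simp add: cls split: if_splits) metis
        then show ?thesis using x by (auto intro: quotientI)
      qed
    qed
    have notin: "?U \<union> ?W \<notin> ?V // ?R"
    proof
      assume "?U \<union> ?W \<in> ?V // ?R"
      then obtain x where "?U \<union> ?W = ?R `` {x}" by (auto elim: quotientE)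
      hence "(x, u) \<in> ?R" "(x, v) \<in> ?R" using re V by blast+
      then show False using False sy tr by blast
    qed
    have fin: "finite (?V // ?R)"
      using V(1) eq by (auto simp: quotient_def)
    \<comment> \<open>Two old classes go and one class that was not there before comes in. This
      bound makes the natural-number computation n - 2 + 1 = n - 1 valid.\<close>
    have "card {?U, ?W} \<le> card (?V // ?R)"
      using in_quot fin by (intro card_mono) auto
    hence "card (?V // ?R') = card (?V // ?R) - 1"
      using notin fin in_quot ne unfolding quot by (simp add: card_Diff_subset)
    moreover have "card (?V // ?R) > 0" using fin in_quot by (auto simp: card_gt_0_iff)
    ultimately show ?thesis using False joined_iff by (simp add: num_components_def)
  qed
qed

text \<open>Gives the conditional odds of \<open>e\<close> without dividing: everything independent
  of the state of \<open>e\<close> is collected in \<open>s\<close>, which may vanish.\<close>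

lemma pmf_FK_edge:
  assumes G: "finite_graph G" and p: "edge_params G p" and q: "q > 0"
    and e: "e \<in> edges G" and \<omega>: "\<omega> \<subseteq> edges G" "e \<notin> \<omega>"
  obtains s where "s \<ge> 0" "pmf (FK G p q) (insert e \<omega>) = p e * s"
    "pmf (FK G p q) \<omega> = (1 - p e) * q ^ cut_index G e \<omega> * s"
proof
  let ?R = "\<Prod>f\<in>edges G - {e}. if f \<in> \<omega> then p f else 1 - p f"
  let ?s = "q ^ num_components G (insert e \<omega>) * ?R / FK_partition G p q"
  have fin: "finite (edges G)" using G by (simp add: finite_graph_def)
  have Z: "FK_partition G p q > 0" using G p q by (rule FK_partition_pos)
  have R: "?R \<ge> 0" using p by (intro prod_nonneg) (auto simp: edge_params_def)
  then show "?s \<ge> 0" using Z q by auto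
  have prod1: "(\<Prod>f\<in>edges G. if f \<in> insert e \<omega> then p f else 1 - p f) = p e * ?R"
    unfolding prod.remove[OF fin e] by (auto intro!: prod.cong arg_cong2[where f = "(*)"])
  have prod0: "(\<Prod>f\<in>edges G. if f \<in> \<omega> then p f else 1 - p f) = (1 - p e) * ?R"
    unfolding prod.remove[OF fin e] using \<omega> by simp
  show "pmf (FK G p q) (insert e \<omega>) = p e * ?s"
    using e \<omega> unfolding pmf_FK[OF G p q] FK_weight_def prod1 by simp
  show "pmf (FK G p q) \<omega> = (1 - p e) * q ^ cut_index G e \<omega> * ?s"
    using \<omega> unfolding pmf_FK[OF G p q] FK_weight_def prod0
      num_components_insert[OF G \<omega>(1) e] by (simp add: power_add)
qed

lemma set_pmf_FK:
  assumes "finite_graph G" "edge_params G p" "q > 0"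
  shows "set_pmf (FK G p q) \<subseteq> Pow (edges G)"
  using pmf_FK[OF assms] by (auto simp: set_pmf_iff split: if_splits)

lemma FK_cong:
  assumes "\<And>e. e \<in> edges G \<Longrightarrow> p e = p' e"
  shows "FK G p q = FK G p' q"
proof -
  have "FK_weight G p q = FK_weight G p' q"
    unfolding FK_weight_def using assms by (intro ext arg_cong2[where f = "(*)"] prod.cong) auto
  then show ?thesis unfolding FK_def FK_partition_def by (simp cong: if_cong)
qed

section \<open>Intersections and unions of FK configurations\<close>

lemma pmf_map_pair_Pow:
  assumes "finite E" "set_pmf \<mu> \<subseteq> Pow E" "set_pmf \<nu> \<subseteq> Pow E"
  shows "pmf (map_pmf (\<lambda>(a, b). h a b) (pair_pmf \<mu> \<nu>)) y =
    (\<Sum>a\<in>Pow E. \<Sum>b\<in>Pow E. if h a b = y then pmf \<mu> a * pmf \<nu> b else 0)"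
proof -
  let ?S = "(Pow E \<times> Pow E) \<inter> {(a, b). h a b = y}"
  have "pmf (map_pmf (\<lambda>(a, b). h a b) (pair_pmf \<mu> \<nu>)) y =
      measure_pmf.prob (pair_pmf \<mu> \<nu>) ((\<lambda>(a, b). h a b) -` {y})"
    by (simp add: pmf_map)
  also have "\<dots> = measure_pmf.prob (pair_pmf \<mu> \<nu>) ?S"
    using assms(2,3) by (intro measure_prob_cong_0) (auto simp: pmf_pair set_pmf_iff)
  also have "\<dots> = (\<Sum>z\<in>?S. pmf (pair_pmf \<mu> \<nu>) z)"
    using assms(1) by (intro measure_measure_pmf_finite) auto
  also have "\<dots> = (\<Sum>z\<in>Pow E \<times> Pow E. if z \<in> {(a, b). h a b = y} then pmf (pair_pmf \<mu> \<nu>) z else 0)"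
    using assms(1) by (intro sum.inter_restrict) auto
  also have "\<dots> = (\<Sum>a\<in>Pow E. \<Sum>b\<in>Pow E. if h a b = y then pmf \<mu> a * pmf \<nu> b else 0)"
    by (simp add: sum.cartesian_product pmf_pair case_prod_unfold cong: if_cong)
       (intro sum.cong; auto simp: pmf_pair)
  finally show ?thesis .
qed

lemma sum_Pow_Pow_insert:
  fixes h :: "'a set \<Rightarrow> 'a set \<Rightarrow> real"
  assumes "finite E" "e \<in> E"
  shows "(\<Sum>a\<in>Pow E. \<Sum>b\<in>Pow E. h a b) = (\<Sum>a\<in>Pow (E - {e}). \<Sum>b\<in>Pow (E - {e}).
    h a b + h a (insert e b) + h (insert e a) b + h (insert e a) (insert e b))"
proof -
  have E: "E = insert e (E - {e})" using assms(2) by auto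
  have "(\<Sum>a\<in>Pow E. f a) = (\<Sum>a\<in>Pow (E - {e}). f a + f (insert e a))" for f :: "'a set \<Rightarrow> real"
    using sum_Pow_insert[of "E - {e}" e f] assms(1) E by simp
  then show ?thesis
    by (simp add: sum.distrib add_ac)
qed

context
  fixes E :: "'e set" and \<mu> \<nu> :: "'e set pmf" and e :: 'e
  assumes fin: "finite E" and supp: "set_pmf \<mu> \<subseteq> Pow E" "set_pmf \<nu> \<subseteq> Pow E" and e: "e \<in> E"
begin

text \<open>Summing over the pair of configurations outside \<open>e\<close> leaves the three joint
  states of \<open>e\<close> that are not open in both. The laws can then be compared separately for
  each fixed pair.\<close>

lemma pmf_inter_law_closed:
  assumes "e \<notin> y"
  shows "pmf (inter_law \<mu> \<nu>) y = (\<Sum>a\<in>Pow (E - {e}). \<Sum>b\<in>Pow (E - {e}). if a \<inter> b = y then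
    pmf \<mu> a * pmf \<nu> b + pmf \<mu> a * pmf \<nu> (insert e b) + pmf \<mu> (insert e a) * pmf \<nu> b else 0)"
  unfolding inter_law_def pmf_map_pair_Pow[OF fin supp] sum_Pow_Pow_insert[OF fin e]
  using assms by (intro sum.cong refl) auto

lemma pmf_inter_law_open:
  assumes "e \<notin> y"
  shows "pmf (inter_law \<mu> \<nu>) (insert e y) = (\<Sum>a\<in>Pow (E - {e}). \<Sum>b\<in>Pow (E - {e}).
    if a \<inter> b = y then pmf \<mu> (insert e a) * pmf \<nu> (insert e b) else 0)"
proof -
  have "insert e a \<inter> insert e b = insert e y \<longleftrightarrow> a \<inter> b = y"
      "a \<inter> b \<noteq> insert e y" "a \<inter> insert e b \<noteq> insert e y" "insert e a \<inter> b \<noteq> insert e y"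
    if "a \<in> Pow (E - {e})" "b \<in> Pow (E - {e})" for a b
    using that assms insert_ident[of e "a \<inter> b" y] by auto
  then show ?thesis
    unfolding inter_law_def pmf_map_pair_Pow[OF fin supp] sum_Pow_Pow_insert[OF fin e]
    by (intro sum.cong refl) simp
qed

lemma pmf_union_law_closed:
  assumes "e \<notin> y"
  shows "pmf (union_law \<mu> \<nu>) y = (\<Sum>a\<in>Pow (E - {e}). \<Sum>b\<in>Pow (E - {e}).
    if a \<union> b = y then pmf \<mu> a * pmf \<nu> b else 0)"
  unfolding union_law_def pmf_map_pair_Pow[OF fin supp] sum_Pow_Pow_insert[OF fin e]
  using assms by (intro sum.cong refl) auto

lemma pmf_union_law_open:
  assumes "e \<notin> y"
  shows "pmf (union_law \<mu> \<nu>) (insert e y) = (\<Sum>a\<in>Pow (E - {e}). \<Sum>b\<in>Pow (E - {e}). if a \<union> b = y then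
    pmf \<mu> a * pmf \<nu> (insert e b) + pmf \<mu> (insert e a) * pmf \<nu> b
      + pmf \<mu> (insert e a) * pmf \<nu> (insert e b) else 0)"
proof -
  have "insert e a \<union> insert e b = insert e y \<longleftrightarrow> a \<union> b = y"
      "a \<union> insert e b = insert e y \<longleftrightarrow> a \<union> b = y" "insert e a \<union> b = insert e y \<longleftrightarrow> a \<union> b = y"
      "a \<union> b \<noteq> insert e y"
    if "a \<in> Pow (E - {e})" "b \<in> Pow (E - {e})" for a b
    using that assms insert_ident[of e "a \<union> b" y] by auto
  then show ?thesis
    unfolding union_law_def pmf_map_pair_Pow[OF fin supp] sum_Pow_Pow_insert[OF fin e]
    by (intro sum.cong refl) simp
qed

end

section \<open>Elementary inequalities for the odds of one edge\<close>

text \<open>\<open>A\<close>, \<open>B\<close> and \<open>M\<close> stand for powers of the cluster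
  weights. Each of the three terms is bounded through \<open>M\<close>, and the remaining
  coefficients add up to \<open>1 - x * x'\<close>.\<close>

lemma inter_odds:
  fixes x x' :: real
  assumes "0 \<le> x" "x \<le> 1" "0 \<le> x'" "x' \<le> 1" "A * B \<le> M" "A \<le> M" "B \<le> M"
  shows "(1 - x) * A * ((1 - x') * B) + (1 - x) * A * x' + x * ((1 - x') * B) \<le> (1 - x * x') * M"
proof -
  have "((1 - x) * (1 - x')) * (A * B) \<le> ((1 - x) * (1 - x')) * M"
    "((1 - x) * x') * A \<le> ((1 - x) * x') * M" "(x * (1 - x')) * B \<le> (x * (1 - x')) * M"
    using assms by (intro mult_left_mono; simp)+
  then show ?thesis by (simp add: algebra_simps)
qed

text \<open>Lowering \<open>q\<close> and \<open>q'\<close> to 1 turns the denominator into the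
  total mass of two independent Bernoulli variables.\<close>

lemma p_hat_denominator:
  fixes x x' :: real
  assumes "q \<ge> 1" "q' \<ge> 1" "0 \<le> x" "x \<le> 1" "0 \<le> x'" "x' \<le> 1"
  shows "(1 - x) * (1 - x') + x * x' + x * q' * (1 - x') + x' * q * (1 - x) \<ge> 1"
proof -
  have "x * (1 - x') * 1 \<le> x * (1 - x') * q'" "x' * (1 - x) * 1 \<le> x' * (1 - x) * q"
    using assms by (intro mult_left_mono; simp)+
  then show ?thesis by (simp add: algebra_simps)
qed

text \<open>The odds of \<open>p_hat\<close> are \<open>N\<close> over
  \<open>(1 - x) * (1 - x')\<close>, and the three hypotheses on \<open>C\<close> match the three
  terms of \<open>N\<close>. Equality holds at \<open>A = q\<close>, \<open>B = q'\<close>,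
  \<open>C = q * q'\<close>, the case of endpoints disconnected in every configuration; this
  explains the formula for \<open>p_hat\<close>.\<close>

lemma union_odds:
  fixes x x' :: real
  assumes q: "q \<ge> 1" "q' \<ge> 1" and x: "0 \<le> x" "x \<le> 1" "0 \<le> x'" "x' \<le> 1"
    and le: "C \<le> A * B" "B * C \<le> A * B * q'" "A * C \<le> A * B * q"
  shows "((1 - x) * A * x' + x * ((1 - x') * B) + x * x') * ((1 - p_hat q q' x x') * C)
    \<le> (1 - x) * A * ((1 - x') * B) * p_hat q q' x x'"
proof -
  define N where "N = x * x' + x * q' * (1 - x') + x' * q * (1 - x)"
  define D where "D = (1 - x) * (1 - x') + N"
  have D: "D \<ge> 1"
    using p_hat_denominator[OF q x] by (simp add: D_def N_def)
  have hat: "p_hat q q' x x' = N / D" "1 - p_hat q q' x x' = (1 - x) * (1 - x') / D"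
    using D by (auto simp: p_hat_def N_def D_def field_simps)
  have "(x * x') * C \<le> (x * x') * (A * B)"
    "(x * (1 - x')) * (B * C) \<le> (x * (1 - x')) * (A * B * q')"
    "(x' * (1 - x)) * (A * C) \<le> (x' * (1 - x)) * (A * B * q)"
    using le x by (intro mult_left_mono; simp)+
  hence "((1 - x) * A * x' + x * ((1 - x') * B) + x * x') * C \<le> A * B * N"
    by (simp add: N_def algebra_simps)
  hence "((1 - x) * (1 - x') / D) * (((1 - x) * A * x' + x * ((1 - x') * B) + x * x') * C)
      \<le> ((1 - x) * (1 - x') / D) * (A * B * N)"
    using x D by (intro mult_left_mono) auto
  then show ?thesis unfolding hat(2) unfolding hat(1) by (simp add: ac_simps)
qed

text \<open>The last claim serves the degenerate edges of the union:
  \<open>1 - p_hat q q' x x'\<close> is \<open>K\<close> over the denominator, so a parameter equal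
  to 1 forces the value 1.\<close>

lemma p_hat_bounds:
  assumes "q \<ge> 1" "q' \<ge> 1" "0 \<le> x" "x \<le> 1" "0 \<le> x'" "x' \<le> 1"
  shows "0 \<le> p_hat q q' x x'" "p_hat q q' x x' \<le> 1"
    "p_hat q q' x x' \<noteq> 1 \<Longrightarrow> x \<noteq> 1 \<and> x' \<noteq> 1"
proof -
  define K where "K = (1 - x) * (1 - x')"
  define N where "N = x * x' + x * q' * (1 - x') + x' * q * (1 - x)"
  have hat: "p_hat q q' x x' = N / (K + N)"
    by (simp add: p_hat_def K_def N_def add_ac)
  have pos: "K + N \<ge> 1"
    using p_hat_denominator[OF assms] by (simp add: K_def N_def add_ac)
  have "K \<ge> 0" using assms by (simp add: K_def)
  moreover have "N \<ge> 0" using assms by (simp add: N_def)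
  ultimately show "0 \<le> p_hat q q' x x'" "p_hat q q' x x' \<le> 1"
    using pos by (simp_all add: hat)
  assume "p_hat q q' x x' \<noteq> 1"
  hence "K \<noteq> 0" using pos by (auto simp: hat)
  then show "x \<noteq> 1 \<and> x' \<noteq> 1" by (auto simp: K_def)
qed

section \<open>Domination by intersections and of unions\<close>

context
  fixes G :: "('v, 'e) graph" and p p' :: "'e \<Rightarrow> real" and q q' :: real
  assumes G: "finite_graph G" and p: "edge_params G p" and p': "edge_params G p'"
    and q: "q \<ge> 1" and q': "q' \<ge> 1"
begin

lemma finite_edges: "finite (edges G)"
  using G by (simp add: finite_graph_def)

lemma qq': "q * q' \<ge> 1"
  using mult_mono[of 1 q 1 q'] q q' by simp

text \<open>Monotonicity enters here: opening more edges can only join the endpoints of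
  \<open>e\<close>, and cluster weights at least 1 turn this into an order on the factors in the
  odds.\<close>

lemma cut_power_bounds:
  assumes "a \<subseteq> b"
  shows "1 \<le> q ^ cut_index G e b" "q ^ cut_index G e b \<le> q ^ cut_index G e a"
    "1 \<le> q' ^ cut_index G e b" "q' ^ cut_index G e b \<le> q' ^ cut_index G e a"
  using q q' cut_index_antimono[OF assms, of G e] by (auto intro: power_increasing)

text \<open>For a fixed pair \<open>a\<close>, \<open>b\<close> outside \<open>e\<close> with
  intersection \<open>y\<close>, both contain \<open>x\<close>, so the odds compare by
  \<open>inter_odds\<close>; summing over all such pairs gives the single-edge condition.\<close>

lemma FK_product_dominated:
  "stoch_dominated (edges G) (FK G (\<lambda>e. p e * p' e) (q * q')) (inter_law (FK G p q) (FK G p' q'))"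
proof (rule Holley_single_edge[OF finite_edges])
  let ?\<mu> = "FK G p q" and ?\<nu> = "FK G p' q'" and ?\<rho> = "FK G (\<lambda>e. p e * p' e) (q * q')"
  have supp: "set_pmf ?\<mu> \<subseteq> Pow (edges G)" "set_pmf ?\<nu> \<subseteq> Pow (edges G)"
    using set_pmf_FK[OF G p] set_pmf_FK[OF G p'] q q' by auto
  have pp': "edge_params G (\<lambda>e. p e * p' e)"
    using p p' by (auto simp: edge_params_def intro: mult_le_one)
  show "set_pmf ?\<rho> \<subseteq> Pow (edges G)"
    using set_pmf_FK[OF G pp'] qq' by auto
  show "set_pmf (inter_law ?\<mu> ?\<nu>) \<subseteq> Pow (edges G)"
    using supp by (auto simp: inter_law_def)
  {
    fix x y e assume xy: "x \<subseteq> y" "y \<subseteq> edges G" and e: "e \<in> edges G" "e \<notin> y"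
    have pe: "0 \<le> p e" "p e \<le> 1" "0 \<le> p' e" "p' e \<le> 1"
      using p p' e by (auto simp: edge_params_def)
    obtain s where s: "s \<ge> 0" "pmf ?\<rho> (insert e x) = p e * p' e * s"
        "pmf ?\<rho> x = (1 - p e * p' e) * (q * q') ^ cut_index G e x * s"
      using pmf_FK_edge[OF G pp' _ e(1), of "q * q'" x] xy e qq' by auto
    have pair_le: "pmf ?\<rho> (insert e x) * (pmf ?\<mu> a * pmf ?\<nu> b + pmf ?\<mu> a * pmf ?\<nu> (insert e b)
          + pmf ?\<mu> (insert e a) * pmf ?\<nu> b)
        \<le> pmf ?\<rho> x * (pmf ?\<mu> (insert e a) * pmf ?\<nu> (insert e b))"
      if ab: "a \<subseteq> edges G - {e}" "b \<subseteq> edges G - {e}" "a \<inter> b = y" for a b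
    proof -
      let ?A = "q ^ cut_index G e a" and ?B = "q' ^ cut_index G e b"
      let ?M = "(q * q') ^ cut_index G e x"
      obtain t where t: "t \<ge> 0" "pmf ?\<mu> (insert e a) = p e * t" "pmf ?\<mu> a = (1 - p e) * ?A * t"
        using pmf_FK_edge[OF G p _ e(1), of q a] ab q by auto
      obtain t' where t': "t' \<ge> 0" "pmf ?\<nu> (insert e b) = p' e * t'"
          "pmf ?\<nu> b = (1 - p' e) * ?B * t'"
        using pmf_FK_edge[OF G p' _ e(1), of q' b] ab q' by auto
      have sub: "x \<subseteq> a" "x \<subseteq> b" using xy ab by auto
      have "?A * ?B \<le> ?M" "?A * 1 \<le> ?M" "1 * ?B \<le> ?M"
        unfolding power_mult_distrib
        using cut_power_bounds[OF sub(1), of e] cut_power_bounds[OF sub(2), of e] q q'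
        by (intro mult_mono; linarith)+
      hence "(1 - p e) * ?A * ((1 - p' e) * ?B) + (1 - p e) * ?A * p' e + p e * ((1 - p' e) * ?B)
          \<le> (1 - p e * p' e) * ?M"
        using pe by (intro inter_odds) auto
      \<comment> \<open>The multiplier is the factor common to both sides once every probability is
        written by \<open>pmf_FK_edge\<close>.\<close>
      hence "(p e * p' e * s * t * t') * ((1 - p e) * ?A * ((1 - p' e) * ?B)
          + (1 - p e) * ?A * p' e + p e * ((1 - p' e) * ?B))
          \<le> (p e * p' e * s * t * t') * ((1 - p e * p' e) * ?M)"
        using pe s t t' by (intro mult_left_mono) auto
      then show ?thesis
        unfolding s(2,3) t(2,3) t'(2,3) by (simp only: distrib_left distrib_right mult_ac)
    qed
    show "pmf ?\<rho> (insert e x) * pmf (inter_law ?\<mu> ?\<nu>) y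
        \<le> pmf ?\<rho> x * pmf (inter_law ?\<mu> ?\<nu>) (insert e y)"
      unfolding pmf_inter_law_closed[OF finite_edges supp e] pmf_inter_law_open[OF finite_edges supp e]
        sum_distrib_left
      using pair_le by (intro sum_mono) auto
  next
    fix x y e assume xy: "x \<subseteq> edges G" "y \<subseteq> edges G" and e: "e \<in> edges G" "e \<notin> x" "e \<notin> y"
      and zero: "pmf ?\<rho> x = 0" "pmf ?\<rho> (insert e x) \<noteq> 0"
    have pe: "0 \<le> p e" "p e \<le> 1" "0 \<le> p' e" "p' e \<le> 1"
      using p p' e by (auto simp: edge_params_def)
    obtain s where s: "s \<ge> 0" "pmf ?\<rho> (insert e x) = p e * p' e * s"
        "pmf ?\<rho> x = (1 - p e * p' e) * (q * q') ^ cut_index G e x * s"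
      using pmf_FK_edge[OF G pp' _ e(1), of "q * q'" x] xy e qq' by auto
    \<comment> \<open>Since \<open>s\<close> and the power of \<open>q * q'\<close> are nonzero,
      only \<open>1 - p e * p' e\<close> can vanish. Then \<open>e\<close> is almost surely open in
      both configurations, hence in their intersection.\<close>
    have "p e * p' e = 1"
      using zero s qq' q q' by auto
    moreover have "p e * p' e \<le> p e * 1" "p e * p' e \<le> 1 * p' e"
      using pe by (intro mult_mono; simp)+
    ultimately have one: "p e = 1" "p' e = 1" using pe by auto
    have "pmf ?\<mu> a = 0" "pmf ?\<nu> a = 0" if "a \<in> Pow (edges G - {e})" for a
      using pmf_FK_edge[OF G p _ e(1), of q a] pmf_FK_edge[OF G p' _ e(1), of q' a] that q q' one
      by auto
    then show "pmf (inter_law ?\<mu> ?\<nu>) y = 0"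
      unfolding pmf_inter_law_closed[OF finite_edges supp e(1,3)]
      by (intro sum.neutral ballI) simp
  }
qed

text \<open>The inclusions are reversed: a pair with union \<open>x\<close> lies below
  \<open>y\<close>, so endpoints joined in \<open>a\<close> or \<open>b\<close> are joined in
  \<open>y\<close>, and \<open>union_odds\<close> applies pair by pair.\<close>

lemma FK_union_dominated:
  "stoch_dominated (edges G) (union_law (FK G p q) (FK G p' q'))
    (FK G (\<lambda>e. p_hat q q' (p e) (p' e)) (q * q'))"
proof (rule Holley_single_edge[OF finite_edges])
  let ?h = "\<lambda>e. p_hat q q' (p e) (p' e)"
  let ?\<mu> = "FK G p q" and ?\<nu> = "FK G p' q'" and ?\<rho> = "FK G ?h (q * q')"
  have supp: "set_pmf ?\<mu> \<subseteq> Pow (edges G)" "set_pmf ?\<nu> \<subseteq> Pow (edges G)"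
    using set_pmf_FK[OF G p] set_pmf_FK[OF G p'] q q' by auto
  have ph: "edge_params G ?h"
    using p p' p_hat_bounds(1,2)[OF q q'] by (simp add: edge_params_def)
  show "set_pmf ?\<rho> \<subseteq> Pow (edges G)"
    using set_pmf_FK[OF G ph] qq' by auto
  show "set_pmf (union_law ?\<mu> ?\<nu>) \<subseteq> Pow (edges G)"
    using supp by (auto simp: union_law_def)
  {
    fix x y e assume xy: "x \<subseteq> y" "y \<subseteq> edges G" and e: "e \<in> edges G" "e \<notin> y"
    have ex: "e \<notin> x" using xy e by auto
    have pe: "0 \<le> p e" "p e \<le> 1" "0 \<le> p' e" "p' e \<le> 1"
      using p p' e by (auto simp: edge_params_def)
    obtain s where s: "s \<ge> 0" "pmf ?\<rho> (insert e y) = ?h e * s"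
        "pmf ?\<rho> y = (1 - ?h e) * (q * q') ^ cut_index G e y * s"
      using pmf_FK_edge[OF G ph _ e(1), of "q * q'" y] xy e qq' by auto
    have pair_le: "(pmf ?\<mu> a * pmf ?\<nu> (insert e b) + pmf ?\<mu> (insert e a) * pmf ?\<nu> b
          + pmf ?\<mu> (insert e a) * pmf ?\<nu> (insert e b)) * pmf ?\<rho> y
        \<le> pmf ?\<mu> a * pmf ?\<nu> b * pmf ?\<rho> (insert e y)"
      if ab: "a \<subseteq> edges G - {e}" "b \<subseteq> edges G - {e}" "a \<union> b = x" for a b
    proof -
      let ?A = "q ^ cut_index G e a" and ?B = "q' ^ cut_index G e b"
      let ?C = "(q * q') ^ cut_index G e y"
      obtain t where t: "t \<ge> 0" "pmf ?\<mu> (insert e a) = p e * t" "pmf ?\<mu> a = (1 - p e) * ?A * t"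
        using pmf_FK_edge[OF G p _ e(1), of q a] ab q by auto
      obtain t' where t': "t' \<ge> 0" "pmf ?\<nu> (insert e b) = p' e * t'"
          "pmf ?\<nu> b = (1 - p' e) * ?B * t'"
        using pmf_FK_edge[OF G p' _ e(1), of q' b] ab q' by auto
      have sub: "a \<subseteq> y" "b \<subseteq> y" using xy ab by auto
      note cb = cut_power_bounds[OF sub(1), of e] cut_power_bounds[OF sub(2), of e]
      have C: "?C \<le> ?A * ?B"
        unfolding power_mult_distrib using cb q q' by (intro mult_mono; linarith)
      have AB: "1 \<le> ?A" "1 \<le> ?B" using cb by linarith+
      \<comment> \<open>One factor of \<open>?C\<close> is bounded by monotonicity, the other by the
        exponent being at most 1.\<close>
      have Cq: "?C \<le> ?A * q'" "?C \<le> ?B * q"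
      proof -
        have "q ^ cut_index G e y \<le> q" "q' ^ cut_index G e y \<le> q'" using q q' by auto
        then have "q ^ cut_index G e y * q' ^ cut_index G e y \<le> ?A * q'"
          "q' ^ cut_index G e y * q ^ cut_index G e y \<le> ?B * q"
          using cb q q' by (intro mult_mono; linarith)+
        then show "?C \<le> ?A * q'" "?C \<le> ?B * q"
          unfolding power_mult_distrib by (simp_all only: mult.commute)
      qed
      have "?B * ?C \<le> ?B * (?A * q')" "?A * ?C \<le> ?A * (?B * q)"
        using Cq AB by (intro mult_left_mono; linarith)+
      hence "((1 - p e) * ?A * p' e + p e * ((1 - p' e) * ?B) + p e * p' e) * ((1 - ?h e) * ?C)
          \<le> (1 - p e) * ?A * ((1 - p' e) * ?B) * ?h e"
        using pe q q' C by (intro union_odds) (auto simp only: mult_ac)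
      hence "(s * t * t') * (((1 - p e) * ?A * p' e + p e * ((1 - p' e) * ?B) + p e * p' e)
            * ((1 - ?h e) * ?C))
          \<le> (s * t * t') * ((1 - p e) * ?A * ((1 - p' e) * ?B) * ?h e)"
        using s t t' by (intro mult_left_mono) auto
      then show ?thesis
        unfolding s(2,3) t(2,3) t'(2,3) by (simp only: distrib_left distrib_right mult_ac)
    qed
    show "pmf (union_law ?\<mu> ?\<nu>) (insert e x) * pmf ?\<rho> y
        \<le> pmf (union_law ?\<mu> ?\<nu>) x * pmf ?\<rho> (insert e y)"
      unfolding pmf_union_law_closed[OF finite_edges supp e(1) ex]
        pmf_union_law_open[OF finite_edges supp e(1) ex] sum_distrib_right
      using pair_le by (intro sum_mono) auto
  next
    fix x y e assume xy: "x \<subseteq> edges G" "y \<subseteq> edges G" and e: "e \<in> edges G" "e \<notin> x" "e \<notin> y"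
      and zero: "pmf (union_law ?\<mu> ?\<nu>) x = 0" "pmf (union_law ?\<mu> ?\<nu>) (insert e x) \<noteq> 0"
    have pe: "0 \<le> p e" "p e \<le> 1" "0 \<le> p' e" "p' e \<le> 1"
      using p p' e by (auto simp: edge_params_def)
    show "pmf ?\<rho> y = 0"
    \<comment> \<open>If \<open>pmf ?\<rho> y\<close> were nonzero, neither measure would force
      \<open>e\<close> open. Every pair with union \<open>x\<close> has a null member, which stays
      null when \<open>e\<close> is opened, so \<open>insert e x\<close> would be null for the union
      law.\<close>
    proof (rule ccontr)
      assume "pmf ?\<rho> y \<noteq> 0"
      moreover obtain s where "s \<ge> 0" "pmf ?\<rho> (insert e y) = ?h e * s"
          "pmf ?\<rho> y = (1 - ?h e) * (q * q') ^ cut_index G e y * s"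
        using pmf_FK_edge[OF G ph _ e(1), of "q * q'" y] xy e qq' by auto
      ultimately have "?h e \<noteq> 1" by auto
      hence ne1: "p e \<noteq> 1" "p' e \<noteq> 1"
        using p_hat_bounds(3)[OF q q' pe] by simp_all
      have open_zero: "pmf (FK G r t) (insert e a) = 0"
        if a: "pmf (FK G r t) a = 0" "a \<in> Pow (edges G - {e})"
          "edge_params G r" "r e \<noteq> 1" "t \<ge> 1" for a r t
      proof -
        obtain s where "s \<ge> 0" "pmf (FK G r t) (insert e a) = r e * s"
            "pmf (FK G r t) a = (1 - r e) * t ^ cut_index G e a * s"
          using pmf_FK_edge[OF G a(3) _ e(1), of t a] a(2,5) by auto
        then show ?thesis using a(1,4,5) by simp
      qed
      have fin: "finite (Pow (edges G - {e}))" using finite_edges by simp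
      have closed_zero: "pmf ?\<mu> a = 0 \<or> pmf ?\<nu> b = 0"
        if "a \<in> Pow (edges G - {e})" "b \<in> Pow (edges G - {e})" "a \<union> b = x" for a b
      proof -
        let ?f = "\<lambda>a b. if a \<union> b = x then pmf ?\<mu> a * pmf ?\<nu> b else 0"
        have "(\<Sum>b\<in>Pow (edges G - {e}). ?f a b) = 0"
          using zero(1) that(1) unfolding pmf_union_law_closed[OF finite_edges supp e(1,2)]
          by (intro sum_nonneg_0[OF fin, of "\<lambda>a. \<Sum>b\<in>Pow (edges G - {e}). ?f a b" a])
             (simp_all add: sum_nonneg)
        hence "?f a b = 0"
          using that(2) by (intro sum_nonneg_0[OF fin, of "?f a" b]) simp_all
        then show ?thesis using that(3) by simp
      qed
      have "pmf ?\<mu> a * pmf ?\<nu> (insert e b) + pmf ?\<mu> (insert e a) * pmf ?\<nu> b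
          + pmf ?\<mu> (insert e a) * pmf ?\<nu> (insert e b) = 0"
        if ab: "a \<in> Pow (edges G - {e})" "b \<in> Pow (edges G - {e})" "a \<union> b = x" for a b
        using closed_zero[OF ab]
      proof
        assume "pmf ?\<mu> a = 0"
        then show ?thesis using open_zero[OF _ ab(1) p ne1(1) q] by simp
      next
        assume "pmf ?\<nu> b = 0"
        then show ?thesis using open_zero[OF _ ab(2) p' ne1(2) q'] by simp
      qed
      hence "pmf (union_law ?\<mu> ?\<nu>) (insert e x) = 0"
        unfolding pmf_union_law_open[OF finite_edges supp e(1,2)]
        by (intro sum.neutral ballI) simp
      then show False using zero(2) by simp
    qed
  }
qed

end

text \<open>The function \<open>r\<close> encodes the edgewise ratio, with an arbitrary value in the
  unit interval wherever the denominator vanishes.\<close>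

theorem theorem1p1:
  fixes G :: "('v, 'e) graph"
  assumes "finite_graph G"
  shows
    "(\<forall>(q::real) (p::'e \<Rightarrow> real) (p'::'e \<Rightarrow> real) (r::'e \<Rightarrow> real).
        q \<ge> 1 \<and> edge_params G p \<and> edge_params G p' \<and> (\<forall>e\<in>edges G. p e \<le> p' e) \<and>
        edge_params G r \<and> (\<forall>e\<in>edges G. p' e \<noteq> 0 \<longrightarrow> r e = p e / p' e) \<longrightarrow>
        stoch_dominated (edges G) (FK G p q) (inter_law (FK G p' q) (Ber G r)))
     \<and>
     (\<forall>(q::real) (q'::real) (p::'e \<Rightarrow> real) (p'::'e \<Rightarrow> real).
        q \<ge> 1 \<and> q' \<ge> 1 \<and> edge_params G p \<and> edge_params G p' \<longrightarrow>
        stoch_dominated (edges G)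
          (FK G (\<lambda>e. p e * p' e) (q * q')) (inter_law (FK G p q) (FK G p' q')) \<and>
        stoch_dominated (edges G)
          (union_law (FK G p q) (FK G p' q')) (FK G (\<lambda>e. p_hat q q' (p e) (p' e)) (q * q')))"
proof (intro conjI allI impI; elim conjE)
  fix q :: real and p p' r :: "'e \<Rightarrow> real"
  assume q: "q \<ge> 1" and p: "edge_params G p" "edge_params G p'" "edge_params G r"
    and le: "\<forall>e\<in>edges G. p e \<le> p' e" and r: "\<forall>e\<in>edges G. p' e \<noteq> 0 \<longrightarrow> r e = p e / p' e"
  \<comment> \<open>At a vanishing \<open>p' e\<close> the product is right for any
    \<open>r e\<close>, as \<open>p e\<close> is squeezed to 0.\<close>
  have "p' e * r e = p e" if "e \<in> edges G" for e
  proof (cases "p' e = 0")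
    case True
    then show ?thesis using le p(1) that by (force simp: edge_params_def)
  next
    case False
    then show ?thesis using r that by simp
  qed
  hence "FK G (\<lambda>e. p' e * r e) q = FK G p q"
    by (rule FK_cong)
  \<comment> \<open>The Bernoulli measure is the FK measure of cluster weight 1, so the product of
    the weights remains \<open>q\<close>.\<close>
  then show "stoch_dominated (edges G) (FK G p q) (inter_law (FK G p' q) (Ber G r))"
    using FK_product_dominated[OF assms p(2,3) q, of 1] by (simp add: Ber_def)
qed (use FK_product_dominated[OF assms] FK_union_dominated[OF assms] in blast)+

end
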